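(* Let $\Sigma$ be an X-network. Then there exists an extended system $\hat\Sigma$ of $\Sigma$, composed of subsystems with homogeneous internal dynamics, which is structurally controllable.
   Context: **Original network.** $\Sigma$ is the structured system $\dot x=Ax+Bu$, $y=x$ (so the output matrix is $C=I_n$), with $x\in\mathbb{R}^n$, $u\in\mathbb{R}^m$. Each entry of $A\in\mathbb{R}^{n\times n}$ and $B\in\mathbb{R}^{n\times m}$ is either fixed to zero or a free (independent, arbitrary real) parameter, and all diagonal entries of $A$ are fixed to zero. The $i$-th component $x_i$ is the state of the $i$-th (first-order) subsystem; $a_{ij}$ ($i\neq j$) are the off-diagonal entries of $A$ and $b_{i,s}$ the entries of $B$. For entries of a structured matrix, "$\neq 0$" means "is a free parameter". **Extended system.** An extended system of $\Sigma$ is a structured system $\hat\Sigma$: $\dot{\hat x}=\hat A\hat x+\hat Bu$, $\hat y=\hat C\hat x$, with orders $\hat n_i\ge 1$ ($i=1,\dots,n$), $\hat n=\sum_i\hat n_i$, $\hat x=(\hat x_1,\dots,\hat x_n)$, $\hat x_i\in\mathbb{R}^{\hat n_i}$. The diagonal blocks of $\hat A$ are $\hat a_i\in\mathbb{R}^{\hat n_i\times\hat n_i}$ and the off-diagonal blocks are $\hat a_{ij}\in\mathbb{R}^{\hat n_i\times\hat n_j}$; $\hat B$ has block rows $\hat b_i\in\mathbb{R}^{\hat n_i\times m}$ with columns $\hat b_{i,s}$; $\hat C=\mathrm{diag}(\hat c_1,\dots,\hat c_n)\in\mathbb{R}^{n\times\hat n}$ with $\hat c_i\in\mathbb{R}^{1\times\hat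 n_i}$. Each entry of these matrices is free or fixed subject to the following. The entries of $\hat a_{ij}$ ($i\ne j$) may be free only if $a_{ij}\neq 0$, and are otherwise zero. The entries of $\hat b_{i,s}$ may be free only if $b_{i,s}\neq0$, and are otherwise zero. For each $i$, the entries of $\hat a_i$ are either all free (heterogeneous internal dynamics) or all fixed to zero (trivial internal dynamics). All entries of $\hat c_i$ are free if $\hat n_i>1$, and $\hat c_i=1$ if $\hat n_i=1$. The subsystems of $\hat\Sigma$ have homogeneous internal dynamics if $\hat a_i=0$ for all $i$. **Structural controllability.** A structured system with state dimension $N$ and matrices $(A,B)$ is structurally controllable if for some choice of the free parameters $[B\ AB\ \cdots\ A^{N-1}B]$ has full row rank. **Graph.** To a structured system associate the directed graph whose nodes are the state nodes $x_1,\dots,x_N$ and the input nodes $u_1,\dots,u_m$, with an edge $(x_i,x_j)$ iff $A_{ji}\ne0$ and an edge $(u_i,x_j)$ iff $B_{ji}\neq0$. It is denoted $\mathrm G(\Sigma)$ for $\Sigma$. A stem is a sequence of distinct nodes $v_1,\dots,v_\ell$ with $(v_k,v_{k+1})$ an edge for all $k$, $v_1$ an input node and $v_\ell$ a state node. A cycle is a closed sequence $v_1,\dots,v_\ell=v_1$ with $(v_k,v_{k+1})$ an edge for all $k$ and $v_1,\dots,v_{\ell-1}$ distinct (self-loops included). A set of stems and cycles covers a set of nodes if each of these nodes lies on some member. The system is input-accessible if every state node is the end vertex of a stem. **Conditions on a set $\mathcal P$ of stems and cycles.** $\mathcal P$ contains: 1) a stem and a cycle sharing some node; 2) two (distinct)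 cycles sharing some node; 3) two stems sharing some node and originating from different input nodes; 4) two (distinct) stems originating from the same input node. **X-network.** An input-accessible network $\Sigma$ is an X-network if it is not structurally controllable and there exists a set of stems and cycles covering all state nodes of $\mathrm G(\Sigma)$ that satisfies (at least one of) conditions 1), 2), 3), but not 4). *)

theory Defs
  imports
    "Graph_Theory.Graph_Theory"
    "Jordan_Normal_Form.DL_Rank"
begin

section \<open>Structured systems\<close>

text \<open>
  An entry of a structured matrix is a known constant or an independent real parameter.
  The usual \<open>a\<^sub>i\<^sub>j \<noteq> 0\<close> for entries of structured matrices means that the entry is \<open>Free\<close>.
  All indices are 0-based.
\<close>

datatype entry = Fixed real | Free

record structured_system =
  sys_A :: "entry mat"
  sys_B :: "entry mat"
  sys_C :: "entry mat"

definition realizations :: "entry mat \<Rightarrow> real mat set" where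
  "realizations M = {R \<in> carrier_mat (dim_row M) (dim_col M).
     \<forall>i < dim_row M. \<forall>j < dim_col M. \<forall>c. M $$ (i, j) = Fixed c \<longrightarrow> R $$ (i, j) = c}"

text \<open>\<open>[B  AB  \<dots>  A\<^sup>N\<^sup>-\<^sup>1B]\<close>: column \<open>j\<close> is column \<open>j mod m\<close> of \<open>A\<^sup>k B\<close> with \<open>k = j div m\<close>.\<close>

definition controllability_matrix :: "real mat \<Rightarrow> real mat \<Rightarrow> real mat" where
  "controllability_matrix A B = (let N = dim_row A; m = dim_col B in
     mat N (N * m) (\<lambda>(i, j). (A ^\<^sub>m (j div m) * B) $$ (i, j mod m)))"

definition structurally_controllable :: "structured_system \<Rightarrow> bool" where
  "structurally_controllable S \<longleftrightarrow>
     (\<exists>A \<in> realizations (sys_A S). \<exists>B \<in> realizations (sys_B S).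
        vec_space.rank (dim_row A) (controllability_matrix A B) = dim_row A)"

definition original_network :: "structured_system \<Rightarrow> bool" where
  "original_network S \<longleftrightarrow> (let n = dim_row (sys_A S); m = dim_col (sys_B S) in
     sys_A S \<in> carrier_mat n n \<and> sys_B S \<in> carrier_mat n m \<and>
     elements_mat (sys_A S) \<subseteq> {Free, Fixed 0} \<and>
     elements_mat (sys_B S) \<subseteq> {Free, Fixed 0} \<and>
     (\<forall>i < n. sys_A S $$ (i, i) = Fixed 0) \<and>
     sys_C S = map_mat Fixed (1\<^sub>m n))"


section \<open>Extended systems\<close>

text \<open>
  \<open>block r c M i j\<close> is the \<open>(i, j)\<close> block of \<open>M\<close>, where \<open>M\<close> is partitioned into block rows of
  heights \<open>r 0, r 1, \<dots>\<close> and block columns of widths \<open>c 0, c 1, \<dots>\<close>.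
\<close>

definition block :: "(nat \<Rightarrow> nat) \<Rightarrow> (nat \<Rightarrow> nat) \<Rightarrow> 'a mat \<Rightarrow> nat \<Rightarrow> nat \<Rightarrow> 'a mat" where
  "block r c M i j =
     mat (r i) (c j) (\<lambda>(p, q). M $$ ((\<Sum>k<i. r k) + p, (\<Sum>k<j. c k) + q))"

text \<open>
  \<open>nh i\<close> is the order of the \<open>i\<close>-th extended subsystem. The extended state and input matrices
  have entries that are free or fixed to zero only.
\<close>

definition extended_system ::
    "structured_system \<Rightarrow> (nat \<Rightarrow> nat) \<Rightarrow> structured_system \<Rightarrow> bool" where
  "extended_system S nh Sh \<longleftrightarrow>
     (let n = dim_row (sys_A S); m = dim_col (sys_B S); N = (\<Sum>i<n. nh i) in
     (\<forall>i < n. nh i \<ge> 1) \<and>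
     sys_A Sh \<in> carrier_mat N N \<and> sys_B Sh \<in> carrier_mat N m \<and> sys_C Sh \<in> carrier_mat n N \<and>
     (\<forall>i < n. \<forall>j < n. i \<noteq> j \<longrightarrow>
        elements_mat (block nh nh (sys_A Sh) i j) \<subseteq>
          (if sys_A S $$ (i, j) = Free then {Free, Fixed 0} else {Fixed 0})) \<and>
     (\<forall>i < n. elements_mat (block nh nh (sys_A Sh) i i) \<subseteq> {Free} \<or>
              elements_mat (block nh nh (sys_A Sh) i i) \<subseteq> {Fixed 0}) \<and>
     (\<forall>i < n. \<forall>s < m.
        elements_mat (block nh (\<lambda>_. 1) (sys_B Sh) i s) \<subseteq>
          (if sys_B S $$ (i, s) = Free then {Free, Fixed 0} else {Fixed 0})) \<and>
     (\<forall>i < n. \<forall>j < n. i \<noteq> j \<longrightarrow>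
        elements_mat (block (\<lambda>_. 1) nh (sys_C Sh) i j) \<subseteq> {Fixed 0}) \<and>
     (\<forall>i < n. elements_mat (block (\<lambda>_. 1) nh (sys_C Sh) i i) \<subseteq>
        (if nh i > 1 then {Free} else {Fixed 1})))"

definition homogeneous_internal_dynamics ::
    "structured_system \<Rightarrow> (nat \<Rightarrow> nat) \<Rightarrow> structured_system \<Rightarrow> bool" where
  "homogeneous_internal_dynamics S nh Sh \<longleftrightarrow>
     (\<forall>i < dim_row (sys_A S). block nh nh (sys_A Sh) i i = map_mat Fixed (0\<^sub>m (nh i) (nh i)))"


section \<open>Graphs, stems and cycles\<close>

datatype node = State nat | Input nat

definition graph_of :: "structured_system \<Rightarrow> node pair_pre_digraph" where
  "graph_of S = (let n = dim_row (sys_A S); m = dim_col (sys_B S) in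
     \<lparr> pverts = State ` {..<n} \<union> Input ` {..<m},
       parcs = {(State i, State j) | i j. i < n \<and> j < n \<and> sys_A S $$ (j, i) = Free} \<union>
               {(Input i, State j) | i j. i < m \<and> j < n \<and> sys_B S $$ (j, i) = Free} \<rparr>)"

definition stem :: "structured_system \<Rightarrow> node list \<Rightarrow> bool" where
  "stem S p \<longleftrightarrow> vpath p (with_proj (graph_of S)) \<and> hd p \<in> range Input \<and> last p \<in> range State"

text \<open>The length condition excludes a single node without an edge; a self-loop is \<open>[v, v]\<close>.\<close>

definition is_cycle :: "structured_system \<Rightarrow> node list \<Rightarrow> bool" where
  "is_cycle S p \<longleftrightarrow> vwalk p (with_proj (graph_of S)) \<and> length p \<ge> 2 \<and> hd p = last p \<and>
     distinct (butlast p)"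

text \<open>Closed sequences that differ only in the starting node describe the same cycle.\<close>

definition same_cycle :: "node list \<Rightarrow> node list \<Rightarrow> bool" where
  "same_cycle p q \<longleftrightarrow> (\<exists>k. butlast q = rotate k (butlast p))"

definition input_accessible :: "structured_system \<Rightarrow> bool" where
  "input_accessible S \<longleftrightarrow> (\<forall>i < dim_row (sys_A S). \<exists>p. stem S p \<and> last p = State i)"

definition covers :: "node list set \<Rightarrow> node set \<Rightarrow> bool" where
  "covers P V \<longleftrightarrow> V \<subseteq> (\<Union>p\<in>P. set p)"

definition stem_meets_cycle :: "structured_system \<Rightarrow> node list set \<Rightarrow> bool" where
  "stem_meets_cycle S P \<longleftrightarrow>
     (\<exists>p\<in>P. \<exists>q\<in>P. stem S p \<and> is_cycle S q \<and> set p \<inter> set q \<noteq> {})"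

definition distinct_cycles_meet :: "structured_system \<Rightarrow> node list set \<Rightarrow> bool" where
  "distinct_cycles_meet S P \<longleftrightarrow>
     (\<exists>p\<in>P. \<exists>q\<in>P. is_cycle S p \<and> is_cycle S q \<and> \<not> same_cycle p q \<and> set p \<inter> set q \<noteq> {})"

definition stems_from_different_inputs_meet :: "structured_system \<Rightarrow> node list set \<Rightarrow> bool" where
  "stems_from_different_inputs_meet S P \<longleftrightarrow>
     (\<exists>p\<in>P. \<exists>q\<in>P. stem S p \<and> stem S q \<and> hd p \<noteq> hd q \<and> set p \<inter> set q \<noteq> {})"

definition distinct_stems_from_same_input :: "structured_system \<Rightarrow> node list set \<Rightarrow> bool" where
  "distinct_stems_from_same_input S P \<longleftrightarrow>
     (\<exists>p\<in>P. \<exists>q\<in>P. stem S p \<and> stem S q \<and> p \<noteq> q \<and> hd p = hd q)"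

definition X_network :: "structured_system \<Rightarrow> bool" where
  "X_network S \<longleftrightarrow> original_network S \<and> input_accessible S \<and> \<not> structurally_controllable S \<and>
     (\<exists>P. (\<forall>p\<in>P. stem S p \<or> is_cycle S p) \<and>
          covers P (State ` {..<dim_row (sys_A S)}) \<and>
          (stem_meets_cycle S P \<or> distinct_cycles_meet S P \<or>
             stems_from_different_inputs_meet S P) \<and>
          \<not> distinct_stems_from_same_input S P)"

end

theory Submission
  imports Defs
begin

text \<open>
  Take every state once for each of its occurrences in a finite subfamily of the given stems and
  cycles, with all admissible parameters free. Each occurrence has a predecessor on its stem or cycle,
  and since no two stems start at the same input, this predecessor map is injective: in the extended
  graph the stems and cycles have become disjoint. Input accessibility is inherited, and it remains
  to show that an injective predecessor map and input accessibility imply structural controllability.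

  This is done for the dual system by adding one cycle at a time. The stems alone are observable.
  A cycle with all weights \<open>c\<close>, attached by one edge, makes every trajectory satisfy
  \<open>y\<^sub>k\<^sub>+\<^sub>p = c\<^sup>p y\<^sub>k\<close>, whereas its effect on the rest is a state feedback independent of \<open>c\<close>; for large
  \<open>c\<close> this leaves only the zero trajectory.
\<close>

section \<open>Observability of the dual system\<close>

text \<open>
  Trajectories of the transposed system \<open>y\<^sub>k\<^sub>+\<^sub>1 = A\<^sup>T y\<^sub>k\<close>, \<open>B\<^sup>T y\<^sub>k = 0\<close>, where \<open>a w x\<close> is the
  weight of the edge from \<open>x\<close> to \<open>w\<close>.
\<close>

definition dual_trajectory ::
    "'a set \<Rightarrow> 'a set \<Rightarrow> ('a \<Rightarrow> 'a \<Rightarrow> real) \<Rightarrow> (nat \<Rightarrow> 'a \<Rightarrow> real) \<Rightarrow> bool" where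
  "dual_trajectory U W a y \<longleftrightarrow>
     (\<forall>k. \<forall>x\<in>W. y (Suc k) x = (\<Sum>w\<in>W. a w x * y k w)) \<and>
     (\<forall>k. \<forall>u\<in>U. (\<Sum>w\<in>W. a w u * y k w) = 0)"

definition observable :: "'a set \<Rightarrow> 'a set \<Rightarrow> ('a \<Rightarrow> 'a \<Rightarrow> real) \<Rightarrow> bool" where
  "observable U W a \<longleftrightarrow> (\<forall>y. dual_trajectory U W a y \<longrightarrow> (\<forall>w\<in>W. y 0 w = 0))"

text \<open>A trajectory shifted in time is again a trajectory, so vanishing at time 0 gives
  vanishing at all times.\<close>

lemma observableD:
  assumes "observable U W a" "dual_trajectory U W a y" "w \<in> W"
  shows "y k w = 0"
proof -
  have "dual_trajectory U W a (\<lambda>j. y (k + j))"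
    using assms(2) unfolding dual_trajectory_def by simp
  then have "(\<lambda>j. y (k + j)) 0 w = 0"
    using assms(1,3) unfolding observable_def by blast
  then show ?thesis by simp
qed

text \<open>The functional \<open>y \<mapsto> b\<^sub>u\<^sup>T (A\<^sup>T)\<^sup>j y\<close>; its coefficients are the entries of \<open>A\<^sup>j b\<^sub>u\<close>.\<close>

fun markov :: "'a set \<Rightarrow> ('a \<Rightarrow> 'a \<Rightarrow> real) \<Rightarrow> 'a \<Rightarrow> nat \<Rightarrow> 'a \<Rightarrow> real" where
  "markov W a u 0 w = a w u"
| "markov W a u (Suc j) w = (\<Sum>v\<in>W. a w v * markov W a u j v)"

text \<open>Duality: multiplying the coefficient vector of a functional by \<open>A\<close> amounts
  to evaluating the functional after one step of the transposed dynamics.\<close>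

lemma sum_markov_step:
  assumes "finite W"
  shows "(\<Sum>w\<in>W. markov W a u (Suc j) w * z w) =
         (\<Sum>v\<in>W. markov W a u j v * (\<Sum>w\<in>W. a w v * z w))"
proof -
  have "(\<Sum>w\<in>W. markov W a u (Suc j) w * z w) =
        (\<Sum>w\<in>W. \<Sum>v\<in>W. a w v * markov W a u j v * z w)"
    by (simp add: sum_distrib_right)
  also have "\<dots> = (\<Sum>v\<in>W. \<Sum>w\<in>W. a w v * markov W a u j v * z w)"
    by (rule sum.swap)
  also have "\<dots> = (\<Sum>v\<in>W. markov W a u j v * (\<Sum>w\<in>W. a w v * z w))"
    by (simp add: sum_distrib_left mult_ac)
  finally show ?thesis .
qed

text \<open>The values at \<open>z\<close> of the functionals with index \<open>k\<close> are the
  outputs at time \<open>k\<close> of the trajectory that starts at \<open>z\<close>, so this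
  trajectory has zero output.\<close>

lemma observable_markov:
  assumes "finite W" "observable U W a" "\<And>u j. u \<in> U \<Longrightarrow> (\<Sum>w\<in>W. markov W a u j w * z w) = 0"
    "w \<in> W"
  shows "z w = 0"
proof -
  define L where "L y x = (\<Sum>w\<in>W. a w x * y w)" for y :: "'a \<Rightarrow> real" and x
  define y where "y k = (L ^^ k) z" for k
  have yS: "y (Suc k) = L (y k)" for k by (simp add: y_def)
  have "(\<Sum>w\<in>W. markov W a u j w * y k w) = 0" if "u \<in> U" for u j k
  proof (induction k arbitrary: j)
    case 0
    then show ?case using assms(3)[OF that] by (simp add: y_def)
  next
    case (Suc k)
    have "(\<Sum>w\<in>W. markov W a u j w * y (Suc k) w) = (\<Sum>w\<in>W. markov W a u (Suc j) w * y k w)"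
      unfolding sum_markov_step[OF assms(1)] yS L_def ..
    then show ?case using Suc[of "Suc j"] by (simp only:)
  qed
  from this[of _ 0] have "dual_trajectory U W a y"
    unfolding dual_trajectory_def yS L_def by simp
  from observableD[OF assms(2) this assms(4), of 0] show ?thesis by (simp add: y_def)
qed

text \<open>
  If \<open>d\<close> is minimal with \<open>g = b\<^sub>u\<^sup>T (A\<^sup>T)\<^sup>d e\<^sub>x \<noteq> 0\<close>, the vanishing output forces
  \<open>b\<^sub>u\<^sup>T (A\<^sup>T)\<^sup>d\<^sup>+\<^sup>1 y\<^sub>k = - g s\<^sub>k\<close>: the disturbance \<open>s\<close> entering at \<open>x\<close> is a state feedback.
\<close>

lemma disturbance_is_feedback:
  assumes fin: "finite W" and obs: "observable U W a" and x: "x \<in> W"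
  obtains l where "\<And>y s k.
    (\<And>k v. v \<in> W \<Longrightarrow> y (Suc k) v = (\<Sum>w\<in>W. a w v * y k w) + (if v = x then s k else 0)) \<Longrightarrow>
    (\<And>k u. u \<in> U \<Longrightarrow> (\<Sum>w\<in>W. a w u * y k w) = 0) \<Longrightarrow>
    s k = (\<Sum>w\<in>W. l w * y k w)"
proof -
  \<comment> \<open>Otherwise all functionals would annihilate the unit vector at \<open>x\<close>,
    against observability.\<close>
  have "\<exists>u\<in>U. \<exists>j. markov W a u j x \<noteq> 0"
  proof (rule ccontr)
    assume neg: "\<not> ?thesis"
    have "(\<Sum>w\<in>W. markov W a u j w * (if w = x then 1 else 0)) = 0" if "u \<in> U" for u j
      using neg that fin x by (simp add: if_distrib cong: if_cong)
    from observable_markov[OF fin obs this x] show False by simp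
  qed
  then obtain u j where u: "u \<in> U" and j: "markov W a u j x \<noteq> 0" by blast
  define d where "d = (LEAST j. markov W a u j x \<noteq> 0)"
  have d: "markov W a u d x \<noteq> 0" unfolding d_def by (rule LeastI[of _ j]) (rule j)
  have lt: "markov W a u i x = 0" if "i < d" for i using not_less_Least that unfolding d_def by blast
  show ?thesis
  proof
    fix y s k
    assume step: "\<And>k v. v \<in> W \<Longrightarrow>
        y (Suc k) v = (\<Sum>w\<in>W. a w v * y k w) + (if v = x then s k else 0)"
      and out: "\<And>k u. u \<in> U \<Longrightarrow> (\<Sum>w\<in>W. a w u * y k w) = 0"
    have shift: "(\<Sum>w\<in>W. markov W a u (Suc i) w * y k w) =
        (\<Sum>v\<in>W. markov W a u i v * y (Suc k) v) - markov W a u i x * s k" for i k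
    proof -
      have "(\<Sum>v\<in>W. markov W a u i v * y (Suc k) v) =
          (\<Sum>v\<in>W. markov W a u i v * (\<Sum>w\<in>W. a w v * y k w) +
                (if v = x then markov W a u i x * s k else 0))"
        by (rule sum.cong) (auto simp: step algebra_simps)
      then show ?thesis
        unfolding sum_markov_step[OF fin] using fin x by (simp add: sum.distrib)
    qed
    \<comment> \<open>Below index \<open>d\<close> the coefficient at \<open>x\<close> vanishes, so
      the disturbance stays invisible and the zero output passes on from one functional to the
      next.\<close>
    have zero: "(\<Sum>w\<in>W. markov W a u i w * y k w) = 0" if "i \<le> d" for i k
      using that
    proof (induction i arbitrary: k)
      case 0
      then show ?case using out[OF u] by simp
    next
      case (Suc i)
      then show ?case using lt[of i] unfolding shift by simp
    qed
    have "(\<Sum>w\<in>W. markov W a u (Suc d) w * y k w) = - markov W a u d x * s k"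
      unfolding shift zero[OF order.refl] by simp
    then have "s k = - (\<Sum>w\<in>W. markov W a u (Suc d) w * y k w) / markov W a u d x"
      using d by (simp add: field_simps)
    also have "\<dots> = (\<Sum>w\<in>W. - markov W a u (Suc d) w / markov W a u d x * y k w)"
      by (simp add: sum_divide_distrib sum_negf del: markov.simps)
    finally show "s k = (\<Sum>w\<in>W. (- markov W a u (Suc d) w / markov W a u d x) * y k w)" .
  qed
qed

section \<open>Attaching one cycle to an observable system\<close>

text \<open>In the sum norm one step multiplies the size by at most \<open>K\<close>, the sum of the
  absolute values of all entries of \<open>F\<close>. Hence \<open>p\<close> steps give a factor of
  at most \<open>K ^ p < c ^ p\<close>, whereas periodicity demands exactly
  \<open>c ^ p\<close>.\<close>

lemma fast_growth_zero:
  fixes F :: "'a \<Rightarrow> 'a \<Rightarrow> real"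
  assumes fin: "finite W" and step: "\<And>k v. v \<in> W \<Longrightarrow> y (Suc k) v = (\<Sum>w\<in>W. F v w * y k w)"
    and per: "\<And>k v. v \<in> W \<Longrightarrow> y (k + p) v = c ^ p * y k v"
    and p: "p > 0" and c: "c > (\<Sum>v\<in>W. \<Sum>w\<in>W. \<bar>F v w\<bar>)" and v: "v \<in> W"
  shows "y k v = 0"
proof -
  define K where "K = (\<Sum>v\<in>W. \<Sum>w\<in>W. \<bar>F v w\<bar>)"
  define N where "N k = (\<Sum>v\<in>W. \<bar>y k v\<bar>)" for k
  have K0: "K \<ge> 0" unfolding K_def by (intro sum_nonneg) simp
  have N0: "N k \<ge> 0" for k unfolding N_def by (intro sum_nonneg) simp
  have NS: "N (Suc k) \<le> K * N k" for k
  proof -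
    have "\<bar>y (Suc k) v\<bar> \<le> (\<Sum>w\<in>W. \<bar>F v w\<bar>) * N k" if "v \<in> W" for v
    proof -
      have "\<bar>y (Suc k) v\<bar> \<le> (\<Sum>w\<in>W. \<bar>F v w * y k w\<bar>)"
        unfolding step[OF that] by (rule sum_abs)
      also have "\<dots> \<le> (\<Sum>w\<in>W. \<bar>F v w\<bar> * N k)"
        using fin unfolding N_def abs_mult
        by (intro sum_mono mult_left_mono) (auto intro: member_le_sum)
      finally show ?thesis by (simp add: sum_distrib_right)
    qed
    then have "N (Suc k) \<le> (\<Sum>v\<in>W. (\<Sum>w\<in>W. \<bar>F v w\<bar>) * N k)"
      unfolding N_def[of "Suc k"] by (rule sum_mono)
    then show ?thesis by (simp add: K_def sum_distrib_right)
  qed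
  have Np: "N (k + j) \<le> K ^ j * N k" for j
  proof (induction j)
    case (Suc j)
    have "N (k + Suc j) \<le> K * N (k + j)" using NS by simp
    also have "\<dots> \<le> K * (K ^ j * N k)" using Suc K0 by (rule mult_left_mono)
    finally show ?case by simp
  qed simp
  have c0: "c > K" "c \<ge> 0" using c K0 unfolding K_def by auto
  have "c ^ p * N k = N (k + p)"
    unfolding N_def using per c0 by (simp add: abs_mult sum_distrib_left)
  also have "\<dots> \<le> K ^ p * N k" by (rule Np)
  finally have "(c ^ p - K ^ p) * N k \<le> 0" by (simp add: algebra_simps)
  moreover have "c ^ p - K ^ p > 0" using power_strict_mono[OF c0(1) K0, of p] p by simp
  ultimately have "N k = 0" using N0[of k] by (simp add: mult_le_0_iff)
  then show ?thesis using fin v unfolding N_def by (simp add: sum_nonneg_eq_0_iff)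
qed

text \<open>The cycle acts on \<open>W \<union> U\<close> only through the value
  \<open>y k w\<close>, which enters at \<open>x\<close> and is multiplied by \<open>c ^ p\<close>
  in \<open>p\<close> steps. It therefore cancels in \<open>y (k + p) - c ^ p * y k\<close>, which
  on \<open>W\<close> is a trajectory of the old system and so zero. Thus the part on
  \<open>W\<close> also grows by \<open>c ^ p\<close> in \<open>p\<close> steps, although its own
  one-step dynamics do not depend on \<open>c\<close>.\<close>

lemma observable_attach_cycle:
  assumes fin: "finite W" "finite C" and obs: "observable U W a"
    and disj: "W \<inter> C = {}" "U \<inter> C = {}" "U \<inter> W = {}"
    and f: "f ` C \<subseteq> C" "inj_on f C" and w: "w \<in> C"
    and orbit: "C = (\<lambda>i. (f ^^ i) w) ` UNIV" and p: "p > 0" "(f ^^ p) w = w"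
    and x: "x \<in> W \<union> U"
  obtains c where "observable U (W \<union> C)
    (\<lambda>v z. if v \<in> W then (if z \<in> W \<union> U then a v z else 0)
           else (if v \<in> C \<and> z = f v then c else 0) + (if v = w \<and> z = x then 1 else 0))"
proof -
  \<comment> \<open>The signal \<open>s\<close> entering at \<open>x\<close> is a linear function of
    the values on \<open>W\<close>: for a state \<open>x\<close> this is the feedback lemma, for an
    input \<open>x\<close> it is the output equation at \<open>x\<close> itself.\<close>
  have "\<exists>l. \<forall>y s k.
    (\<forall>k. \<forall>v\<in>W. y (Suc k) v = (\<Sum>w\<in>W. a w v * y k w) + (if v = x then s k else 0)) \<longrightarrow>
    (\<forall>k. \<forall>u\<in>U. (\<Sum>w\<in>W. a w u * y k w) + (if u = x then s k else 0) = 0) \<longrightarrow>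
    s k = (\<Sum>w\<in>W. l w * y k w)"
  proof (cases "x \<in> W")
    case True
    then have "u \<noteq> x" if "u \<in> U" for u using disj(3) that by blast
    then show ?thesis
      using disturbance_is_feedback[OF fin(1) obs True] by (smt (verit) add.right_neutral)
  next
    case False
    then have "x \<in> U" using x by blast
    then have "s k = (\<Sum>w\<in>W. (- a w x) * y k w)"
      if "\<forall>k. \<forall>u\<in>U. (\<Sum>w\<in>W. a w u * y k w) + (if u = x then s k else 0) = 0"
      for y and s :: "nat \<Rightarrow> real" and k
      using bspec[OF spec[OF that, of k] \<open>x \<in> U\<close>] by (simp add: sum_negf)
    then show ?thesis by (intro exI[of _ "\<lambda>w. - a w x"]) blast
  qed
  then obtain l where l: "\<And>y s k.
    (\<forall>k. \<forall>v\<in>W. y (Suc k) v = (\<Sum>w\<in>W. a w v * y k w) + (if v = x then s k else 0)) \<Longrightarrow>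
    (\<forall>k. \<forall>u\<in>U. (\<Sum>w\<in>W. a w u * y k w) + (if u = x then s k else 0) = 0) \<Longrightarrow>
    s k = (\<Sum>w\<in>W. l w * y k w)"
    by blast
  \<comment> \<open>\<open>F\<close> is the closed loop on \<open>W\<close>, with the disturbance
    replaced by its feedback. It does not involve \<open>c\<close>, so \<open>c\<close> can be taken
    beyond its growth bound; the added 1 makes this strict and \<open>c\<close> positive.\<close>
  define F where "F v v' = a v' v + (if v = x then l v' else 0)" for v v'
  define c where "c = (\<Sum>v\<in>W. \<Sum>w\<in>W. \<bar>F v w\<bar>) + 1"
  have c0: "c > 0" unfolding c_def by (intro add_nonneg_pos sum_nonneg) auto
  define a' where "a' v z = (if v \<in> W then (if z \<in> W \<union> U then a v z else 0)
       else (if v \<in> C \<and> z = f v then c else 0) + (if v = w \<and> z = x then 1 else 0))" for v z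
  have xC: "x \<notin> C" using x disj by blast
  have "observable U (W \<union> C) a'"
    unfolding observable_def
  proof (intro allI impI)
    fix y assume y: "dual_trajectory U (W \<union> C) a' y"
    have split: "(\<Sum>v\<in>W \<union> C. a' v z * y k v) = (\<Sum>v\<in>W. a' v z * y k v) + (\<Sum>v\<in>C. a' v z * y k v)"
      for z k
      using fin disj by (intro sum.union_disjoint) auto
    have sumW: "(\<Sum>v\<in>W. a' v z * y k v) = (if z \<in> W \<union> U then \<Sum>v\<in>W. a v z * y k v else 0)" for z k
      by (auto simp: a'_def intro!: sum.neutral)
    have a'C: "a' v z = (if z = f v then c else 0) + (if v = w \<and> z = x then 1 else 0)"
      if "v \<in> C" for v z
    proof -
      have "v \<notin> W" using that disj by blast
      with that show ?thesis unfolding a'_def by (simp only: if_False simp_thms)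
    qed
    have fCW: "f v \<in> C" "f v \<notin> W \<union> U" if "v \<in> C" for v using that f disj by auto
    have sumC1: "(\<Sum>v\<in>C. a' v z * y k v) = (if z = x then y k w else 0)" if "z \<in> W \<union> U" for z k
    proof -
      have "(\<Sum>v\<in>C. a' v z * y k v) = (\<Sum>v\<in>C. if v = w then (if z = x then y k w else 0) else 0)"
      proof (intro sum.cong refl)
        fix v assume v: "v \<in> C"
        have "z \<noteq> f v" using fCW(2)[OF v] that by metis
        then show "a' v z * y k v = (if v = w then (if z = x then y k w else 0) else 0)"
          unfolding a'C[OF v] by simp
      qed
      then show ?thesis using fin w by simp
    qed
    have sumC2: "(\<Sum>v\<in>C. a' v (f v') * y k v) = c * y k v'" if "v' \<in> C" for v' k
    proof -
      have "(\<Sum>v\<in>C. a' v (f v') * y k v) = (\<Sum>v\<in>C. if v = v' then c * y k v' else 0)"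
      proof (intro sum.cong refl)
        fix v assume v: "v \<in> C"
        have "f v' \<noteq> x" using fCW(1)[OF that] xC by blast
        moreover have "f v' = f v \<longleftrightarrow> v = v'" using inj_onD[OF f(2) _ that v] by blast
        ultimately show "a' v (f v') * y k v = (if v = v' then c * y k v' else 0)"
          unfolding a'C[OF v] by simp
      qed
      then show ?thesis using fin that by simp
    qed
    have yC: "y (Suc k) (f v) = c * y k v" if "v \<in> C" for v k
    proof -
      note fv = fCW[OF that]
      then have "y (Suc k) (f v) = (\<Sum>v'\<in>W \<union> C. a' v' (f v) * y k v')"
        using y unfolding dual_trajectory_def by blast
      then show ?thesis unfolding split sumW sumC2[OF that] using fv by simp
    qed
    have yW: "y (Suc k) v = (\<Sum>w\<in>W. a w v * y k w) + (if v = x then y k w else 0)"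
      if "v \<in> W" for v k
    proof -
      have "y (Suc k) v = (\<Sum>v'\<in>W \<union> C. a' v' v * y k v')"
        using y that unfolding dual_trajectory_def by blast
      then show ?thesis unfolding split sumW using that sumC1[of v] by simp
    qed
    have yU: "(\<Sum>w\<in>W. a w u * y k w) + (if u = x then y k w else 0) = 0"
      if "u \<in> U" for u k
    proof -
      have "(\<Sum>v'\<in>W \<union> C. a' v' u * y k v') = 0"
        using y that unfolding dual_trajectory_def by blast
      then show ?thesis unfolding split sumW using that sumC1[of u] by simp
    qed
    have fC: "(f ^^ i) v \<in> C" if "v \<in> C" for i v
      using that f(1) by (induction i) auto
    have yCi: "y (k + i) ((f ^^ i) v) = c ^ i * y k v" if "v \<in> C" for v k i
      using that
    proof (induction i)
      case (Suc i)
      then show ?case using yC[OF fC[OF Suc.prems], of "k + i" i] by simp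
    qed simp
    \<comment> \<open>Since powers of \<open>f\<close> commute, \<open>f ^^ p\<close> fixes with
      \<open>w\<close> every point of its orbit.\<close>
    have perC: "y (k + p) v = c ^ p * y k v" if v: "v \<in> C" for v k
    proof -
      obtain i where "v = (f ^^ i) w" using v orbit by blast
      then have "(f ^^ p) v = v" using p(2) by (metis add.commute funpow_add o_apply)
      then show ?thesis using yCi[OF v, of k p] by simp
    qed
    \<comment> \<open>The disturbance satisfies \<open>y (k + p) w = c ^ p * y k w\<close>, so it
      drops out of the equations for \<open>z\<close>.\<close>
    define z where "z k v = y (k + p) v - c ^ p * y k v" for k v
    have sum_z: "(\<Sum>w\<in>W. a w v * z k w) =
        (\<Sum>w\<in>W. a w v * y (k + p) w) - c ^ p * (\<Sum>w\<in>W. a w v * y k w)" for v k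
      by (simp add: z_def algebra_simps sum_subtractf sum_distrib_left)
    have "dual_trajectory U W a z"
      unfolding dual_trajectory_def
    proof (intro conjI allI ballI)
      fix k v assume v: "v \<in> W"
      show "z (Suc k) v = (\<Sum>w\<in>W. a w v * z k w)"
        unfolding sum_z unfolding z_def using yW[OF v, of k] yW[OF v, of "k + p"] perC[OF w, of k]
        by (simp add: algebra_simps)
    next
      fix k u assume u: "u \<in> U"
      show "(\<Sum>w\<in>W. a w u * z k w) = 0"
      proof (cases "u = x")
        case True
        have "(\<Sum>w\<in>W. a w u * y j w) = - y j w" for j using yU[OF u, of j] True by simp
        then show ?thesis unfolding sum_z using perC[OF w, of k] by simp
      next
        case False
        then show ?thesis unfolding sum_z using yU[OF u] by simp
      qed
    qed
    from observableD[OF obs this] have perW: "y (k + p) v = c ^ p * y k v" if "v \<in> W" for v k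
      using that unfolding z_def by simp
    have feedback: "y k w = (\<Sum>v\<in>W. l v * y k v)" for k
      by (rule l[of y "\<lambda>k. y k w"]) (use yW yU in auto)
    have "y (Suc k) v = (\<Sum>w\<in>W. F v w * y k w)" if "v \<in> W" for v k
      unfolding yW[OF that] feedback F_def by (simp add: algebra_simps sum.distrib)
    from fast_growth_zero[OF fin(1) this perW p(1)]
    have zeroW: "y k v = 0" if "v \<in> W" for k v using that by (simp add: c_def)
    have zero_w: "y k w = 0" for k unfolding feedback using zeroW by simp
    have "y k v = 0" if v: "v \<in> C" for k v
    proof -
      obtain i where i: "v = (f ^^ i) w" using v orbit by blast
      \<comment> \<open>From \<open>(f ^^ i) w\<close>, another \<open>i * (p - 1)\<close>
        applications of \<open>f\<close> complete \<open>i\<close> rounds and end at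
        \<open>w\<close>, where \<open>y\<close> is already known to vanish.\<close>
      have "c ^ (i * (p - 1)) * y k v = y (k + i * (p - 1)) ((f ^^ (i * (p - 1))) v)"
        by (simp add: yCi[OF v])
      also have "(f ^^ (i * (p - 1))) v = (f ^^ (i * p)) w"
        using p(1) unfolding i by (cases p) (simp_all add: add.commute flip: funpow_add[THEN fun_cong, simplified])
      also have "\<dots> = w"
      proof (induction i)
        case (Suc i)
        then show ?case using p(2) by (simp add: funpow_add)
      qed simp
      finally show ?thesis using zero_w c0 by simp
    qed
    then show "\<forall>w\<in>W \<union> C. y 0 w = 0" using zeroW by blast
  qed
  then show ?thesis using that unfolding a'_def by blast
qed

section \<open>Observable weights from a predecessor map: first the stems, then cycle by
  cycle\<close>

text \<open>The nodes from which iterating the predecessor map \<open>f\<close> leads to an input.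
  If \<open>V\<close> is finite and \<open>f\<close> is injective on \<open>V\<close> with values in
  \<open>V \<union> U\<close>, then \<open>f\<close> permutes the remaining nodes, which thus split
  into cycles.\<close>

inductive_set stem_nodes :: "'a set \<Rightarrow> 'a set \<Rightarrow> ('a \<Rightarrow> 'a) \<Rightarrow> 'a set"
  for U V :: "'a set" and f :: "'a \<Rightarrow> 'a" where
  first: "v \<in> V \<Longrightarrow> f v \<in> U \<Longrightarrow> v \<in> stem_nodes U V f"
| later: "v \<in> V \<Longrightarrow> f v \<in> stem_nodes U V f \<Longrightarrow> v \<in> stem_nodes U V f"

text \<open>By injectivity the sum at \<open>f v\<close> has the single term \<open>y k v\<close>.
  This is either an output, hence zero, or the value at the predecessor one step later; the
  induction runs along the stem from its input.\<close>

lemma observable_stem_nodes: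
  assumes fin: "finite V" and inj: "inj_on f V"
  shows "observable U (stem_nodes U V f)
    (\<lambda>w x. if w \<in> stem_nodes U V f \<and> x = f w then 1 else 0)"
    (is "observable U ?S ?a")
  unfolding observable_def
proof (intro allI impI ballI)
  fix y w assume y: "dual_trajectory U ?S ?a y" and "w \<in> ?S"
  have sub: "?S \<subseteq> V" by (auto elim: stem_nodes.cases)
  have sum: "(\<Sum>w\<in>?S. ?a w (f v) * y k w) = y k v" if v: "v \<in> ?S" for v k
  proof -
    have "(\<Sum>w\<in>?S. ?a w (f v) * y k w) = (\<Sum>w\<in>?S. if w = v then y k v else 0)"
    proof (rule sum.cong)
      fix w assume w: "w \<in> ?S"
      then have "f v = f w \<longleftrightarrow> w = v" using inj_onD[OF inj] v sub by blast
      then show "?a w (f v) * y k w = (if w = v then y k v else 0)" using w by simp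
    qed simp
    then show ?thesis using v finite_subset[OF sub fin] by simp
  qed
  have "y k w = 0" for k
    using \<open>w \<in> ?S\<close>
  proof (induction arbitrary: k)
    case (first v)
    then have "v \<in> ?S" by (rule stem_nodes.first)
    moreover have "(\<Sum>w\<in>?S. ?a w (f v) * y k w) = 0"
      using y first(2) unfolding dual_trajectory_def by blast
    ultimately show ?case using sum by (simp only:)
  next
    case (later v)
    then have "v \<in> ?S" by (blast intro: stem_nodes.later)
    moreover have "y (Suc k) (f v) = (\<Sum>w\<in>?S. ?a w (f v) * y k w)"
      using y later(2) unfolding dual_trajectory_def by blast
    ultimately show ?case using sum later.IH by (simp only:)
  qed
  then show "y 0 w = 0" .
qed

text \<open>Finiteness makes two iterates of \<open>w\<close> equal, and injectivity cancels their
  common power of \<open>f\<close>.\<close>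

lemma funpow_returns:
  assumes fin: "finite D" and D: "f ` D \<subseteq> D" and inj: "inj_on f D" and w: "w \<in> D"
  obtains p where "p > 0" "(f ^^ p) w = w"
proof -
  have mem: "(f ^^ i) v \<in> D" if "v \<in> D" for i v
    using that D by (induction i) auto
  have "range (\<lambda>i. (f ^^ i) w) \<subseteq> D" using mem[OF w] by blast
  then have "finite (range (\<lambda>i. (f ^^ i) w))" using fin by (rule finite_subset)
  then have "\<not> inj (\<lambda>i. (f ^^ i) w)" using finite_imageD by blast
  then obtain i j where ij: "i < j" "(f ^^ i) w = (f ^^ j) w"
    unfolding inj_def by (metis linorder_neqE_nat)
  have cancel: "u = v" if "(f ^^ i) u = (f ^^ i) v" "u \<in> D" "v \<in> D" for i u v
    using that
  proof (induction i)
    case (Suc i)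
    then show ?case using inj_onD[OF inj _ mem mem] by simp
  qed simp
  have "(f ^^ i) w = (f ^^ i) ((f ^^ (j - i)) w)"
    using ij by (metis add_diff_inverse_nat comp_apply funpow_add not_less_iff_gr_or_eq)
  then have "(f ^^ (j - i)) w = w" using cancel mem w by metis
  then show ?thesis using that[of "j - i"] ij(1) by simp
qed

lemma rtrancl_enters:
  assumes "(u, v) \<in> E\<^sup>*" "u \<in> X" "v \<notin> X"
  obtains x w where "(x, w) \<in> E" "x \<in> X" "w \<notin> X"
proof -
  from assms(1) have "v \<in> X \<or> (\<exists>x w. (x, w) \<in> E \<and> x \<in> X \<and> w \<notin> X)"
    by (induction) (use assms(2) in blast)+
  then show ?thesis using assms(3) that by blast
qed

text \<open>Starting from the stem nodes, take a maximal set \<open>W\<close> with observable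
  weights. If a node is missing, accessibility yields an edge from \<open>W \<union> U\<close> to
  some \<open>w\<close> outside. The orbit of \<open>w\<close> under \<open>f\<close> is a cycle
  disjoint from \<open>W\<close>, and this edge attaches it, against maximality.\<close>

lemma observable_weights_exist:
  assumes fin: "finite V" and disj: "U \<inter> V = {}"
    and inj: "inj_on f V" and f: "\<And>v. v \<in> V \<Longrightarrow> f v \<in> V \<union> U" "\<And>v. v \<in> V \<Longrightarrow> (f v, v) \<in> E"
    and acc: "\<And>v. v \<in> V \<Longrightarrow> \<exists>u\<in>U. (u, v) \<in> E\<^sup>*" and E: "E \<subseteq> (V \<union> U) \<times> V"
  obtains a where "\<And>w x. a w x \<noteq> 0 \<Longrightarrow> (x, w) \<in> E" "observable U V a"
proof -
  \<comment> \<open>Because \<open>W\<close> contains all stem nodes, and \<open>v\<close> whenever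
    it contains \<open>f v\<close>, the map \<open>f\<close> sends \<open>V - W\<close> into itself;
    orbits outside \<open>W\<close> are then cycles.\<close>
  define P where "P W \<longleftrightarrow> stem_nodes U V f \<subseteq> W \<and> W \<subseteq> V \<and> (\<forall>v\<in>V. f v \<in> W \<longrightarrow> v \<in> W) \<and>
    (\<exists>a. (\<forall>w x. a w x \<noteq> 0 \<longrightarrow> (x, w) \<in> E) \<and> observable U W a)" for W
  have "P (stem_nodes U V f)"
  proof -
    have "\<exists>a. (\<forall>w x. a w x \<noteq> 0 \<longrightarrow> (x, w) \<in> E) \<and> observable U (stem_nodes U V f) a"
    proof (intro exI conjI)
      show "observable U (stem_nodes U V f)
        (\<lambda>w x. if w \<in> stem_nodes U V f \<and> x = f w then 1 else 0)"
        using fin inj by (rule observable_stem_nodes)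
    qed (auto intro: f(2) elim: stem_nodes.cases)
    then show ?thesis
      unfolding P_def by (auto intro: stem_nodes.later elim: stem_nodes.cases)
  qed
  moreover have "finite {W. P W}"
    by (rule finite_subset[of _ "Pow V"]) (use fin in \<open>auto simp: P_def\<close>)
  ultimately obtain W where W: "P W" and max: "\<And>W'. P W' \<Longrightarrow> W \<subseteq> W' \<Longrightarrow> W' = W"
    using finite_has_maximal[of "{W. P W}"] by blast
  from W obtain a where stems: "stem_nodes U V f \<subseteq> W" and WV: "W \<subseteq> V"
    and closed: "\<And>v. v \<in> V \<Longrightarrow> f v \<in> W \<Longrightarrow> v \<in> W"
    and a: "\<And>w x. a w x \<noteq> 0 \<Longrightarrow> (x, w) \<in> E" and obs: "observable U W a"
    unfolding P_def by blast
  have "W = V"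
  proof (rule ccontr)
    assume "W \<noteq> V"
    then obtain v where v: "v \<in> V" "v \<notin> W" using WV by blast
    then obtain u where u: "u \<in> U" "(u, v) \<in> E\<^sup>*" using acc by blast
    have "v \<notin> W \<union> U" using v disj by blast
    then obtain x w where xw: "(x, w) \<in> E" "x \<in> W \<union> U" "w \<notin> W \<union> U"
      using rtrancl_enters[OF u(2), of "W \<union> U"] u(1) by blast
    define D where "D = V - W"
    have w: "w \<in> D" using xw E unfolding D_def by blast
    have fD: "f v \<in> D" if "v \<in> D" for v
    proof -
      have "f v \<notin> U" using that stems unfolding D_def by (blast intro: stem_nodes.first)
      moreover have "f v \<notin> W" using that closed unfolding D_def by blast
      ultimately show ?thesis using f(1)[of v] that unfolding D_def by blast
    qed
    have finD: "finite D" and injD: "inj_on f D"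
      using fin inj by (auto simp: D_def intro: inj_on_subset)
    obtain p where p: "p > 0" "(f ^^ p) w = w"
      using funpow_returns[OF finD _ injD w] fD by blast
    define C where "C = (\<lambda>i. (f ^^ i) w) ` UNIV"
    have CD: "C \<subseteq> D"
    proof -
      have "(f ^^ i) w \<in> D" for i using w fD by (induction i) auto
      then show ?thesis unfolding C_def by blast
    qed
    have fC: "f ` C \<subseteq> C"
    proof -
      have "f ((f ^^ i) w) = (f ^^ Suc i) w" for i by simp
      then show ?thesis unfolding C_def by blast
    qed
    \<comment> \<open>A preimage of a point of the orbit lies \<open>p - 1\<close> steps further on.
      Together with injectivity this gives \<open>W \<union> C\<close> the closure property demanded
      by \<open>P\<close>.\<close>
    have Cf: "C \<subseteq> f ` C"
    proof -
      have "(f ^^ i) w = f ((f ^^ (i + (p - 1))) w)" for i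
      proof -
        have "f ((f ^^ (i + (p - 1))) w) = (f ^^ (i + p)) w"
          using p(1) by (cases p) simp_all
        then show ?thesis using p(2) by (simp add: funpow_add)
      qed
      then show ?thesis unfolding C_def by blast
    qed
    have wC: "w \<in> C" unfolding C_def by (rule image_eqI[of _ _ 0]) simp_all
    obtain c where c: "observable U (W \<union> C)
      (\<lambda>v z. if v \<in> W then (if z \<in> W \<union> U then a v z else 0)
           else (if v \<in> C \<and> z = f v then c else 0) + (if v = w \<and> z = x then 1 else 0))"
      (is "observable U _ ?a")
    proof (rule observable_attach_cycle[where f = f and w = w and p = p and x = x])
      show "finite W" "finite C" "W \<inter> C = {}" "U \<inter> C = {}" "U \<inter> W = {}"
        using WV CD disj finite_subset[OF WV fin] finite_subset[OF CD finD] by (auto simp: D_def)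
      show "inj_on f C" using injD CD by (rule inj_on_subset)
    qed (use obs fC wC C_def p xw in auto)
    have "P (W \<union> C)"
      unfolding P_def
    proof (intro conjI exI ballI impI allI)
      show "stem_nodes U V f \<subseteq> W \<union> C" using stems by blast
      show "W \<union> C \<subseteq> V" using WV CD D_def by blast
      show "observable U (W \<union> C) ?a" by (rule c)
    next
      fix v assume v: "v \<in> V" "f v \<in> W \<union> C"
      show "v \<in> W \<union> C"
      proof (cases "f v \<in> W")
        case False
        then obtain v' where "v' \<in> C" "f v = f v'" using v Cf by blast
        then show ?thesis using inj_onD[OF inj, of v v'] v CD D_def by blast
      qed (use closed v in blast)
    next
      fix v z assume "?a v z \<noteq> 0"
      then have "a v z \<noteq> 0 \<or> v \<in> C \<and> z = f v \<or> v = w \<and> z = x" by (auto split: if_splits)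
      then show "(z, v) \<in> E" using a f(2) xw(1) CD D_def by blast
    qed
    from max[OF this] show False using wC CD w D_def by blast
  qed
  then show ?thesis using that a obs by blast
qed

section \<open>Structural controllability from an injective predecessor map\<close>

text \<open>If \<open>M * M\<^sup>T\<close> annihilates \<open>v\<close>, then
  \<open>M\<^sup>T *\<^sub>v v\<close> has norm zero. So a trivial left kernel makes this Gram
  matrix invertible, and \<open>M\<^sup>T\<close> times its inverse is a right inverse of
  \<open>M\<close>.\<close>

lemma full_row_rank:
  fixes M :: "real mat"
  assumes M: "M \<in> carrier_mat N nc"
    and ker: "\<And>v. v \<in> carrier_vec N \<Longrightarrow> M\<^sup>T *\<^sub>v v = 0\<^sub>v nc \<Longrightarrow> v = 0\<^sub>v N"
  shows "vec_space.rank N M = N"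
proof -
  interpret vec_space "TYPE(real)" N .
  have MM: "M * M\<^sup>T \<in> carrier_mat N N" using M by simp
  have "det (M * M\<^sup>T) \<noteq> 0"
  proof
    assume "det (M * M\<^sup>T) = 0"
    then obtain v where v: "v \<in> carrier_vec N" "v \<noteq> 0\<^sub>v N" "(M * M\<^sup>T) *\<^sub>v v = 0\<^sub>v N"
      using det_0_iff_vec_prod_zero_field[OF MM] by blast
    have Mv: "M\<^sup>T *\<^sub>v v \<in> carrier_vec nc" using M v by simp
    have "M *\<^sub>v (M\<^sup>T *\<^sub>v v) = 0\<^sub>v N" using v M by (metis assoc_mult_mat_vec transpose_carrier_mat)
    then have "(M\<^sup>T *\<^sub>v v) \<bullet> (M\<^sup>T *\<^sub>v v) = 0"
      using M v Mv by (metis scalar_prod_left_zero comm_scalar_prod transpose_vec_mult_scalar zero_carrier_vec)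
    then have "M\<^sup>T *\<^sub>v v = 0\<^sub>v nc"
      using conjugate_square_eq_0_vec[OF Mv] by simp
    with ker v show False by blast
  qed
  then obtain R where R: "R \<in> carrier_mat N N" "(M * M\<^sup>T) * R = 1\<^sub>m N"
    using det_non_zero_imp_unit[OF MM, of undefined] unfolding Units_def ring_mat_def by auto
  have "col_space M = carrier_vec N"
  proof -
    have "\<exists>x\<in>carrier_vec nc. M *\<^sub>v x = v" if v: "v \<in> carrier_vec N" for v
    proof -
      have Rv: "R *\<^sub>v v \<in> carrier_vec N" using R(1) v by (rule mult_mat_vec_carrier)
      have MT: "M\<^sup>T \<in> carrier_mat nc N" using M by simp
      have "M *\<^sub>v (M\<^sup>T *\<^sub>v (R *\<^sub>v v)) = (M * M\<^sup>T) *\<^sub>v (R *\<^sub>v v)"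
        using assoc_mult_mat_vec[OF M MT Rv] by (rule sym)
      also have "\<dots> = ((M * M\<^sup>T) * R) *\<^sub>v v" using assoc_mult_mat_vec[OF MM R(1) v] by (rule sym)
      also have "\<dots> = v" unfolding R(2) using v by (rule one_mult_mat_vec)
      finally show ?thesis using mult_mat_vec_carrier[OF MT Rv] by blast
    qed
    then show ?thesis using M unfolding col_space_eq[OF M] by auto
  qed
  then have "span (set (cols M)) = carrier V" unfolding col_space_def by simp
  then have "span_vs (set (cols M)) = V" by simp
  then show ?thesis unfolding rank_def by (simp add: dim_is_n)
qed

text \<open>\<open>N + 1\<close> vectors with \<open>N\<close> coordinates are dependent, and the
  relation is solved for the last vector with a nonzero coefficient. For
  \<open>b, A b, A^2 b, ...\<close> this takes the place of the Cayley-Hamilton theorem.\<close>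

lemma linear_recurrence_exists:
  fixes g :: "nat \<Rightarrow> nat \<Rightarrow> real"
  obtains k b where "k \<le> N" "\<And>r. r < N \<Longrightarrow> g k r = (\<Sum>i<k. b i * g i r)"
proof -
  \<comment> \<open>A zero row at the bottom makes the matrix square and singular; a kernel vector
    is the wanted dependence.\<close>
  define M where "M = mat (Suc N) (Suc N) (\<lambda>(r, i). if r < N then g i r else 0)"
  have M: "M \<in> carrier_mat (Suc N) (Suc N)" by (simp add: M_def)
  have "M\<^sup>T *\<^sub>v unit_vec (Suc N) N = 0\<^sub>v (Suc N)"
    by (rule eq_vecI) (simp_all add: M_def)
  moreover have "unit_vec (Suc N) N \<noteq> (0\<^sub>v (Suc N) :: real vec)" by simp
  ultimately have "det M\<^sup>T = 0"
    using det_0_iff_vec_prod_zero_field[of "M\<^sup>T" "Suc N"] M by (meson transpose_carrier_mat unit_vec_carrier)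
  then have "det M = 0" using det_transpose[OF M] by simp
  then obtain v where v: "v \<in> carrier_vec (Suc N)" "v \<noteq> 0\<^sub>v (Suc N)" "M *\<^sub>v v = 0\<^sub>v (Suc N)"
    using det_0_iff_vec_prod_zero_field[OF M] by blast
  have row: "(\<Sum>i<Suc N. g i r * v $ i) = 0" if "r < N" for r
  proof -
    have "(M *\<^sub>v v) $ r = (\<Sum>i<Suc N. g i r * v $ i)"
      using carrier_vecD[OF v(1)] that unfolding M_def
      by (simp add: scalar_prod_def atLeast0LessThan del: sum.lessThan_Suc)
    then show ?thesis using v that by simp
  qed
  define Z where "Z = {i. i < Suc N \<and> v $ i \<noteq> 0}"
  define k where "k = Max Z"
  have "Z \<noteq> {}" using v(1,2) unfolding Z_def by (auto intro!: eq_vecI)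
  moreover have "finite Z" by (simp add: Z_def)
  ultimately have k: "k \<in> Z" and kmax: "\<And>i. i \<in> Z \<Longrightarrow> i \<le> k" unfolding k_def by auto
  have "g k r = (\<Sum>i<k. (- v $ i / v $ k) * g i r)" if "r < N" for r
  proof -
    have "(\<Sum>i<Suc N. g i r * v $ i) = (\<Sum>i<Suc k. g i r * v $ i)"
      using k kmax by (intro sum.mono_neutral_right) (force simp: Z_def)+
    then have "g k r * v $ k = - (\<Sum>i<k. g i r * v $ i)" using row[OF that] by simp
    then have "g k r = - (\<Sum>i<k. g i r * v $ i) / v $ k"
      using k nonzero_eq_divide_eq[of "v $ k"] unfolding Z_def by blast
    then show ?thesis by (simp add: sum_negf sum_divide_distrib mult.commute)
  qed
  from that[OF _ this] show ?thesis using k unfolding Z_def by simp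
qed

text \<open>The relation for \<open>A^k b\<close> is multiplied by \<open>A^j\<close> from the
  left.\<close>

lemma markov_recurrence:
  assumes "\<forall>w\<in>W. markov W a u k w = (\<Sum>i<k. b i * markov W a u i w)" "w \<in> W"
  shows "markov W a u (j + k) w = (\<Sum>i<k. b i * markov W a u (j + i) w)"
  using assms(2)
proof (induction j arbitrary: w)
  case 0
  then show ?case using assms(1) by simp
next
  case (Suc j)
  have "markov W a u (Suc j + k) w = (\<Sum>v\<in>W. \<Sum>i<k. a w v * (b i * markov W a u (j + i) v))"
    using Suc.IH by (simp add: sum_distrib_left)
  also have "\<dots> = (\<Sum>i<k. \<Sum>v\<in>W. a w v * (b i * markov W a u (j + i) v))" by (rule sum.swap)
  also have "\<dots> = (\<Sum>i<k. b i * markov W a u (Suc j + i) w)"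
    by (simp add: sum_distrib_left mult_ac)
  finally show ?case .
qed

text \<open>The controllability matrix holds only the powers below \<open>N\<close>; a recurrence of
  order at most \<open>N\<close> reduces every later functional to earlier ones.\<close>

lemma markov_kernel:
  assumes W: "W = h ` {..<N}"
    and zero: "\<And>k. k < N \<Longrightarrow> (\<Sum>w\<in>W. markov W a u k w * z w) = 0"
  shows "(\<Sum>w\<in>W. markov W a u k w * z w) = 0"
proof -
  obtain k0 b where k0: "k0 \<le> N"
    and "\<And>r. r < N \<Longrightarrow> markov W a u k0 (h r) = (\<Sum>i<k0. b i * markov W a u i (h r))"
    using linear_recurrence_exists[of N "\<lambda>i r. markov W a u i (h r)"] by blast
  then have rec: "\<forall>w\<in>W. markov W a u k0 w = (\<Sum>i<k0. b i * markov W a u i w)"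
    unfolding W by auto
  show ?thesis
  proof (induction k rule: less_induct)
    case (less k)
    show ?case
    proof (cases "k < N")
      case False
      then have k: "k = (k - k0) + k0" using k0 by simp
      have "(\<Sum>w\<in>W. markov W a u k w * z w) =
          (\<Sum>w\<in>W. \<Sum>i<k0. b i * (markov W a u (k - k0 + i) w * z w))"
        by (subst k, rule sum.cong[OF refl], subst markov_recurrence[OF rec])
           (simp_all add: sum_distrib_left sum_distrib_right mult_ac)
      also have "\<dots> = (\<Sum>i<k0. \<Sum>w\<in>W. b i * (markov W a u (k - k0 + i) w * z w))"
        by (rule sum.swap)
      also have "\<dots> = 0"
      proof (rule sum.neutral, rule ballI)
        fix i assume "i \<in> {..<k0}"
        then have "k - k0 + i < k" using k by simp
        from less[OF this] show "(\<Sum>w\<in>W. b i * (markov W a u (k - k0 + i) w * z w)) = 0"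
          by (simp flip: sum_distrib_left)
      qed
      finally show ?thesis .
    qed (use zero in blast)
  qed
qed

text \<open>Matrix powers recurse by a factor on the right, \<open>markov\<close> by one on the
  left.\<close>

lemma pow_mat_Suc_left:
  assumes "A \<in> carrier_mat n n"
  shows "A ^\<^sub>m Suc k = A * A ^\<^sub>m k"
proof (induction k)
  case (Suc k)
  have "A ^\<^sub>m Suc (Suc k) = A * A ^\<^sub>m k * A" using Suc by simp
  also have "\<dots> = A * (A ^\<^sub>m k * A)"
    using assms pow_carrier_mat[OF assms] by (intro assoc_mult_mat)
  finally show ?case by simp
qed (use assms in simp)

lemma markov_eq_pow_mat:
  fixes a :: "node \<Rightarrow> node \<Rightarrow> real" and N m :: nat
  defines "V \<equiv> State ` {..<N}"
  defines "A \<equiv> mat N N (\<lambda>(i, j). a (State i) (State j))"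
  defines "B \<equiv> mat N m (\<lambda>(i, s). a (State i) (Input s))"
  assumes "i < N" "s < m"
  shows "(A ^\<^sub>m k * B) $$ (i, s) = markov V a (Input s) k (State i)"
  using \<open>i < N\<close>
proof (induction k arbitrary: i)
  case 0
  have "A ^\<^sub>m 0 * B = B" by (simp add: A_def B_def)
  then show ?case using 0 \<open>s < m\<close> by (simp add: B_def)
next
  case (Suc k)
  have A: "A \<in> carrier_mat N N" and B: "B \<in> carrier_mat N m" by (simp_all add: A_def B_def)
  have Ak: "A ^\<^sub>m k \<in> carrier_mat N N" using A by simp
  have "A ^\<^sub>m Suc k * B = A * (A ^\<^sub>m k * B)"
    unfolding pow_mat_Suc_left[OF A] using A Ak B by (rule assoc_mult_mat)
  also have "\<dots> $$ (i, s) = (\<Sum>j<N. A $$ (i, j) * (A ^\<^sub>m k * B) $$ (j, s))"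
    using A Ak B Suc.prems \<open>s < m\<close> by (simp add: scalar_prod_def atLeast0LessThan)
  also have "\<dots> = (\<Sum>j<N. a (State i) (State j) * markov V a (Input s) k (State j))"
    using Suc by (intro sum.cong) (auto simp: A_def)
  also have "\<dots> = markov V a (Input s) (Suc k) (State i)"
    by (simp add: V_def sum.reindex inj_on_def)
  finally show ?case .
qed

text \<open>Observable weights supported on the edges give a realization. A vector in the left
  kernel of its controllability matrix is annihilated by the functionals of index below
  \<open>N\<close>, hence by all of them, and so is zero.\<close>

lemma structurally_controllableI:
  assumes A: "sys_A S \<in> carrier_mat N N" and B: "sys_B S \<in> carrier_mat N m"
    and entries: "elements_mat (sys_A S) \<subseteq> {Free, Fixed 0}" "elements_mat (sys_B S) \<subseteq> {Free, Fixed 0}"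
    and inj: "inj_on f (State ` {..<N})"
    and f: "\<And>i. i < N \<Longrightarrow> (f (State i), State i) \<in> parcs (graph_of S)"
    and acc: "\<And>i. i < N \<Longrightarrow> \<exists>s<m. (Input s, State i) \<in> (parcs (graph_of S))\<^sup>*"
  shows "structurally_controllable S"
proof -
  define V where "V = State ` {..<N}"
  define U where "U = Input ` {..<m}"
  define E where "E = parcs (graph_of S)"
  have E_eq: "E = {(State i, State j) | i j. i < N \<and> j < N \<and> sys_A S $$ (j, i) = Free} \<union>
               {(Input i, State j) | i j. i < m \<and> j < N \<and> sys_B S $$ (j, i) = Free}"
    using A B unfolding E_def graph_of_def Let_def by simp
  obtain a where a: "\<And>w x. a w x \<noteq> 0 \<Longrightarrow> (x, w) \<in> E" and obs: "observable U V a"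
  proof (rule observable_weights_exist[of V U f E])
    show E: "E \<subseteq> (V \<union> U) \<times> V" unfolding E_eq V_def U_def by blast
    show fE: "(f v, v) \<in> E" if "v \<in> V" for v using f that unfolding V_def E_def by blast
    show "f v \<in> V \<union> U" if "v \<in> V" for v using E fE[OF that] by blast
    show "\<exists>u\<in>U. (u, v) \<in> E\<^sup>*" if "v \<in> V" for v
      using acc that unfolding V_def U_def E_def by blast
  qed (use inj in \<open>auto simp: V_def U_def\<close>)
  define RA where "RA = mat N N (\<lambda>(i, j). a (State i) (State j))"
  define RB where "RB = mat N m (\<lambda>(i, s). a (State i) (Input s))"
  have "RA \<in> realizations (sys_A S)"
  proof -
    have "RA $$ (i, j) = c" if "i < N" "j < N" "sys_A S $$ (i, j) = Fixed c" for i j c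
    proof -
      have "sys_A S $$ (i, j) \<in> elements_mat (sys_A S)" using A that by blast
      then have "c = 0" using entries(1) that by auto
      moreover have "(State j, State i) \<notin> E" using that unfolding E_eq by auto
      ultimately show ?thesis using a that unfolding RA_def by auto
    qed
    then show ?thesis using A unfolding realizations_def by (auto simp: RA_def)
  qed
  moreover have "RB \<in> realizations (sys_B S)"
  proof -
    have "RB $$ (i, s) = c" if "i < N" "s < m" "sys_B S $$ (i, s) = Fixed c" for i s c
    proof -
      have "sys_B S $$ (i, s) \<in> elements_mat (sys_B S)" using B that by blast
      then have "c = 0" using entries(2) that by auto
      moreover have "(Input s, State i) \<notin> E" using that unfolding E_eq by auto
      ultimately show ?thesis using a that unfolding RB_def by auto
    qed
    then show ?thesis using B unfolding realizations_def by (auto simp: RB_def)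
  qed
  moreover have "vec_space.rank N (controllability_matrix RA RB) = N"
  proof (rule full_row_rank)
    show M: "controllability_matrix RA RB \<in> carrier_mat N (N * m)"
      by (simp add: controllability_matrix_def Let_def RA_def RB_def)
    fix v :: "real vec"
    assume v: "v \<in> carrier_vec N" "(controllability_matrix RA RB)\<^sup>T *\<^sub>v v = 0\<^sub>v (N * m)"
    \<comment> \<open>The vector as a function on nodes; the sums run over state nodes, so the value
      at inputs is a mere default.\<close>
    define z where "z x = (case x of State i \<Rightarrow> v $ i | Input s \<Rightarrow> 0)" for x
    have zero: "(\<Sum>w\<in>V. markov V a (Input s) k w * z w) = 0" if "s < m" "k < N" for s k
    proof -
      \<comment> \<open>Column \<open>m * k + s\<close> of the controllability matrix is column
        \<open>s\<close> of the block with the \<open>k\<close>-th power.\<close>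
      have "m * k + s < m * (k + 1)" using that by simp
      also have "\<dots> \<le> m * N" using that by (intro mult_le_mono) auto
      finally have j: "m * k + s < N * m" by (simp add: mult.commute)
      have "0 = ((controllability_matrix RA RB)\<^sup>T *\<^sub>v v) $ (m * k + s)"
        using v j by simp
      also have "\<dots> = (\<Sum>i<N. controllability_matrix RA RB $$ (i, m * k + s) * v $ i)"
        using M carrier_vecD[OF v(1)] j by (simp add: scalar_prod_def atLeast0LessThan)
      also have "\<dots> = (\<Sum>i<N. markov V a (Input s) k (State i) * v $ i)"
      proof (rule sum.cong)
        fix i assume "i \<in> {..<N}"
        then have "controllability_matrix RA RB $$ (i, m * k + s) = (RA ^\<^sub>m k * RB) $$ (i, s)"
          using j that by (simp add: controllability_matrix_def Let_def RA_def RB_def)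
        then show "controllability_matrix RA RB $$ (i, m * k + s) * v $ i =
            markov V a (Input s) k (State i) * v $ i"
          using markov_eq_pow_mat[of i N s m a k] \<open>i \<in> {..<N}\<close> that
          by (simp add: RA_def RB_def V_def)
      qed simp
      also have "\<dots> = (\<Sum>w\<in>V. markov V a (Input s) k w * z w)"
        by (simp add: V_def sum.reindex inj_on_def z_def)
      finally show ?thesis by simp
    qed
    have "z w = 0" if "w \<in> V" for w
    proof (rule observable_markov[OF _ obs _ that])
      fix u j assume "u \<in> U"
      then obtain s where "s < m" "u = Input s" unfolding U_def by blast
      then show "(\<Sum>w\<in>V. markov V a u j w * z w) = 0"
        using markov_kernel[OF V_def, of a u z j] zero by blast
    qed (simp add: V_def)
    then have "v $ i = 0" if "i < N" for i using that unfolding V_def z_def by force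
    then show "v = 0\<^sub>v N" using v by (intro eq_vecI) auto
  qed
  moreover have "dim_row RA = N" by (simp add: RA_def)
  ultimately show ?thesis unfolding structurally_controllable_def by metis
qed

section \<open>The extension with all admissible parameters\<close>

text \<open>The number of the block that contains row \<open>I\<close>: it is the first block that
  ends beyond \<open>I\<close>.\<close>

definition block_index :: "(nat \<Rightarrow> nat) \<Rightarrow> nat \<Rightarrow> nat" where
  "block_index r I = (LEAST i. I < (\<Sum>k<Suc i. r k))"

lemma block_index_offset:
  assumes "p < r i"
  shows "block_index r ((\<Sum>k<i. r k) + p) = i"
  unfolding block_index_def
proof (rule Least_equality)
  show "(\<Sum>k<i. r k) + p < (\<Sum>k<Suc i. r k)" using assms by simp
next
  fix j assume j: "(\<Sum>k<i. r k) + p < (\<Sum>k<Suc j. r k)"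
  show "i \<le> j"
  proof (rule ccontr)
    assume "\<not> i \<le> j"
    then have "(\<Sum>k<Suc j. r k) \<le> (\<Sum>k<i. r k)" by (intro sum_mono2) auto
    with j show False by simp
  qed
qed

lemma offset_less:
  fixes r :: "nat \<Rightarrow> nat"
  assumes "i < n" "p < r i"
  shows "(\<Sum>k<i. r k) + p < (\<Sum>k<n. r k)"
proof -
  have "(\<Sum>k<Suc i. r k) \<le> (\<Sum>k<n. r k)" using assms by (intro sum_mono2) auto
  then show ?thesis using assms by simp
qed

lemma offset_cases:
  fixes r :: "nat \<Rightarrow> nat"
  assumes "I < (\<Sum>k<n. r k)"
  obtains i p where "i < n" "p < r i" "I = (\<Sum>k<i. r k) + p"
  using assms
proof (induction n arbitrary: thesis)
  case (Suc n)
  show ?case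
  proof (cases "I < (\<Sum>k<n. r k)")
    case True
    show ?thesis by (rule Suc.IH[OF _ True]) (use Suc.prems(1) less_SucI in blast)
  next
    case False
    then show ?thesis
      using Suc.prems(1)[of n "I - (\<Sum>k<n. r k)"] Suc.prems(2) by simp
  qed
qed simp

lemma block_index_less:
  assumes "I < (\<Sum>k<n. r k)"
  shows "block_index r I < n"
  using assms by (elim offset_cases) (simp add: block_index_offset)

text \<open>Each block of the state and input matrices repeats one original entry, so every
  admissible off-diagonal parameter is free. For an original network the zero diagonal makes the
  internal dynamics vanish.\<close>

definition full_extension :: "structured_system \<Rightarrow> (nat \<Rightarrow> nat) \<Rightarrow> structured_system" where
  "full_extension S r = (let n = dim_row (sys_A S); m = dim_col (sys_B S); N = (\<Sum>i<n. r i) in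
     \<lparr> sys_A = mat N N (\<lambda>(I, J). sys_A S $$ (block_index r I, block_index r J)),
       sys_B = mat N m (\<lambda>(I, s). sys_B S $$ (block_index r I, s)),
       sys_C = mat n N (\<lambda>(i, J). if block_index r J \<noteq> i then Fixed 0
                                 else if r i > 1 then Free else Fixed 1) \<rparr>)"

lemma original_network_entries:
  assumes "original_network S" "i < dim_row (sys_A S)"
  shows "j < dim_row (sys_A S) \<Longrightarrow> sys_A S $$ (i, j) \<in> {Free, Fixed 0}"
    and "s < dim_col (sys_B S) \<Longrightarrow> sys_B S $$ (i, s) \<in> {Free, Fixed 0}"
  using assms unfolding original_network_def Let_def by blast+

lemma elements_mat_subsetI:
  assumes "\<And>i j. i < dim_row M \<Longrightarrow> j < dim_col M \<Longrightarrow> M $$ (i, j) \<in> X"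
  shows "elements_mat M \<subseteq> X"
  using assms by blast

lemma full_extension:
  assumes S: "original_network S" and r: "\<And>i. i < dim_row (sys_A S) \<Longrightarrow> r i \<ge> 1"
  shows "extended_system S r (full_extension S r)"
    and "homogeneous_internal_dynamics S r (full_extension S r)"
proof -
  define n where "n = dim_row (sys_A S)"
  define m where "m = dim_col (sys_B S)"
  define N where "N = (\<Sum>i<n. r i)"
  let ?F = "full_extension S r"
  have diag: "sys_A S $$ (i, i) = Fixed 0" if "i < n" for i
    using S that unfolding original_network_def Let_def n_def by blast
  have sel: "sys_A ?F = mat N N (\<lambda>(I, J). sys_A S $$ (block_index r I, block_index r J))"
    "sys_B ?F = mat N m (\<lambda>(I, s). sys_B S $$ (block_index r I, s))"
    "sys_C ?F = mat n N (\<lambda>(i, J). if block_index r J \<noteq> i then Fixed 0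
                                 else if r i > 1 then Free else Fixed 1)"
    unfolding full_extension_def Let_def n_def m_def N_def by simp_all
  have off: "(\<Sum>k<i. r k) + p < N" if "i < n" "p < r i" for i p
    using offset_less[of i n p r] that unfolding N_def by blast
  have A: "block r r (sys_A ?F) i j = mat (r i) (r j) (\<lambda>_. sys_A S $$ (i, j))"
    if "i < n" "j < n" for i j
    by (rule eq_matI) (simp_all add: block_def sel off that block_index_offset)
  have B: "block r (\<lambda>_. 1) (sys_B ?F) i s = mat (r i) 1 (\<lambda>_. sys_B S $$ (i, s))"
    if "i < n" "s < m" for i s
    by (rule eq_matI) (simp_all add: block_def sel off that block_index_offset)
  have C: "block (\<lambda>_. 1) r (sys_C ?F) i j = mat 1 (r j) (\<lambda>_. if j \<noteq> i then Fixed 0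
      else if r i > 1 then Free else Fixed 1)"
    if "i < n" "j < n" for i j
    by (rule eq_matI) (simp_all add: block_def sel off that block_index_offset)
  have entA: "sys_A S $$ (i, j) \<in> {Free, Fixed 0}" if "i < n" "j < n" for i j
    using original_network_entries[OF S] that unfolding n_def by blast
  have entB: "sys_B S $$ (i, s) \<in> {Free, Fixed 0}" if "i < n" "s < m" for i s
    using original_network_entries[OF S] that unfolding n_def m_def by blast
  show "extended_system S r ?F"
    unfolding extended_system_def Let_def
    unfolding n_def[symmetric] m_def[symmetric] N_def[symmetric]
  proof (intro conjI allI impI)
    fix i j assume i: "i < n" and j: "j < n"
    show "elements_mat (block r r (sys_A ?F) i j) \<subseteq>
        (if sys_A S $$ (i, j) = Free then {Free, Fixed 0} else {Fixed 0})"
      unfolding A[OF i j] by (rule elements_mat_subsetI) (use entA[OF i j] in auto)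
  next
    fix i assume i: "i < n"
    show "elements_mat (block r r (sys_A ?F) i i) \<subseteq> {Free} \<or>
        elements_mat (block r r (sys_A ?F) i i) \<subseteq> {Fixed 0}"
      unfolding A[OF i i] by (intro disjI2 elements_mat_subsetI) (simp add: diag i)
  next
    fix i s assume i: "i < n" and s: "s < m"
    show "elements_mat (block r (\<lambda>_. 1) (sys_B ?F) i s) \<subseteq>
        (if sys_B S $$ (i, s) = Free then {Free, Fixed 0} else {Fixed 0})"
      unfolding B[OF i s] by (rule elements_mat_subsetI) (use entB[OF i s] in auto)
  next
    fix i j assume i: "i < n" and j: "j < n" and "i \<noteq> j"
    then show "elements_mat (block (\<lambda>_. 1) r (sys_C ?F) i j) \<subseteq> {Fixed 0}"
      unfolding C[OF i j] by (intro elements_mat_subsetI) simp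
  next
    fix i assume i: "i < n"
    show "elements_mat (block (\<lambda>_. 1) r (sys_C ?F) i i) \<subseteq> (if r i > 1 then {Free} else {Fixed 1})"
      unfolding C[OF i i] by (rule elements_mat_subsetI) simp
  qed (use r in \<open>simp_all add: sel n_def\<close>)
  show "homogeneous_internal_dynamics S r ?F"
    unfolding homogeneous_internal_dynamics_def
  proof (intro allI impI)
    fix i assume "i < dim_row (sys_A S)"
    then have i: "i < n" unfolding n_def .
    show "block r r (sys_A ?F) i i = map_mat Fixed (0\<^sub>m (r i) (r i))"
      unfolding A[OF i i] by (rule eq_matI) (simp_all add: diag i)
  qed
qed

text \<open>The extended graph is a blow-up of the original one: \<open>block_index r\<close> sends
  each copy to its state, and all copies of a state have the same neighbours up to copies.\<close>

lemma parcs_full_extension: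
  fixes S r
  defines "N \<equiv> \<Sum>i<dim_row (sys_A S). r i"
  shows "(State I, State J) \<in> parcs (graph_of (full_extension S r)) \<longleftrightarrow>
      I < N \<and> J < N \<and> (State (block_index r I), State (block_index r J)) \<in> parcs (graph_of S)"
    and "(Input s, State J) \<in> parcs (graph_of (full_extension S r)) \<longleftrightarrow>
      J < N \<and> (Input s, State (block_index r J)) \<in> parcs (graph_of S)"
  using block_index_less[of _ r "dim_row (sys_A S)"]
  by (auto simp: graph_of_def full_extension_def Let_def N_def)

lemma parcs_to_state:
  assumes "(x, y) \<in> parcs (graph_of S)"
  obtains j where "y = State j" "j < dim_row (sys_A S)"
  using assms unfolding graph_of_def Let_def by auto

lemma parcs_from_state:
  assumes "(State i, y) \<in> parcs (graph_of S)"
  shows "i < dim_row (sys_A S)"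
  using assms unfolding graph_of_def Let_def by auto

text \<open>A walk lifts because copies of adjacent nodes are adjacent; \<open>r i \<ge> 1\<close>
  provides a copy of each state passed on the way.\<close>

lemma full_extension_reachable:
  assumes r: "\<And>i. i < dim_row (sys_A S) \<Longrightarrow> r i \<ge> 1"
    and reach: "(Input s, State i) \<in> (parcs (graph_of S))\<^sup>*"
    and J: "J < (\<Sum>i<dim_row (sys_A S). r i)" "block_index r J = i"
  shows "(Input s, State J) \<in> (parcs (graph_of (full_extension S r)))\<^sup>*"
proof -
  let ?N = "\<Sum>i<dim_row (sys_A S). r i"
  let ?E = "parcs (graph_of (full_extension S r))"
  \<comment> \<open>No edge ends in an input, so the only input reachable from
    \<open>Input s\<close> is itself.\<close>
  have "case x of Input s' \<Rightarrow> s' = s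
      | State i \<Rightarrow> \<forall>J<?N. block_index r J = i \<longrightarrow> (Input s, State J) \<in> ?E\<^sup>*"
    if "(Input s, x) \<in> (parcs (graph_of S))\<^sup>*" for x
    using that
  proof (induction)
    case (step y z)
    from step.hyps(2) obtain i where z: "z = State i" by (rule parcs_to_state)
    have "(Input s, State J) \<in> ?E\<^sup>*" if J: "J < ?N" "block_index r J = i" for J
    proof (cases y)
      case (Input s')
      then have "(Input s, State J) \<in> ?E"
        using step J z parcs_full_extension(2) by auto
      then show ?thesis by blast
    next
      case (State k)
      then have k: "k < dim_row (sys_A S)" using step.hyps(2) parcs_from_state by blast
      \<comment> \<open>The first copy of state \<open>k\<close>.\<close>
      define K where "K = (\<Sum>j<k. r j)"
      have K: "K < ?N" "block_index r K = k"
        unfolding K_def using r[OF k] k offset_less[of k _ 0 r] block_index_offset[of 0 r k] by auto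
      then have "(Input s, State K) \<in> ?E\<^sup>*" using step.IH State by simp
      moreover have "(State K, State J) \<in> ?E"
        using step.hyps(2) J K z State parcs_full_extension(1) by auto
      ultimately show ?thesis by (rule rtrancl_into_rtrancl)
    qed
    then show ?case using z by simp
  qed simp
  from this[OF reach] show ?thesis using J by simp
qed

text \<open>\<open>X\<close> is listed fibre by fibre of \<open>h\<close>, the fibre over
  \<open>i\<close> filling block \<open>i\<close>. This lets the states of an extension be labelled
  by the elements of \<open>X\<close>.\<close>

lemma ex_block_enumeration:
  assumes fin: "finite X" and h: "h ` X \<subseteq> {..<n}"
  defines "r \<equiv> \<lambda>i. card {x \<in> X. h x = i}"
  obtains e where "bij_betw e {..<\<Sum>i<n. r i} X" "\<And>I. I < (\<Sum>i<n. r i) \<Longrightarrow> h (e I) = block_index r I"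
proof -
  let ?N = "\<Sum>i<n. r i"
  have "\<exists>g. bij_betw g {..<r i} {x \<in> X. h x = i}" for i
    using ex_bij_betw_nat_finite[of "{x \<in> X. h x = i}"] fin by (simp add: r_def atLeast0LessThan)
  then obtain g where g: "\<And>i. bij_betw (g i) {..<r i} {x \<in> X. h x = i}" by metis
  define e where "e I = g (block_index r I) (I - (\<Sum>k<block_index r I. r k))" for I
  have e: "e ((\<Sum>k<i. r k) + p) = g i p" if "p < r i" for i p
    unfolding e_def block_index_offset[of p r i, OF that] by simp
  have gX: "g i p \<in> X" "h (g i p) = i" if "p < r i" for i p
    using bij_betwE[OF g[of i]] that by auto
  have he: "h (e I) = block_index r I" if I: "I < ?N" for I
  proof -
    obtain i p where "p < r i" "I = (\<Sum>k<i. r k) + p" using I by (rule offset_cases)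
    then show ?thesis using e gX block_index_offset by simp
  qed
  have "bij_betw e {..<?N} X"
  proof (rule bij_betw_imageI)
    show "inj_on e {..<?N}"
    proof (rule inj_onI)
      fix I J assume IJ: "I \<in> {..<?N}" "J \<in> {..<?N}" "e I = e J"
      obtain i p where I: "p < r i" "I = (\<Sum>k<i. r k) + p" using IJ(1) by (auto elim: offset_cases)
      obtain j q where J: "q < r j" "J = (\<Sum>k<j. r k) + q" using IJ(2) by (auto elim: offset_cases)
      have eq: "g i p = g j q" using IJ(3) e I J by simp
      then have "i = j" using gX(2) I J by metis
      moreover from this have "p = q"
        using eq I J bij_betw_imp_inj_on[OF g[of i]] by (auto dest: inj_onD)
      ultimately show "I = J" using I J by simp
    qed
    show "e ` {..<?N} = X"
    proof (intro equalityI subsetI)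
      fix x assume "x \<in> e ` {..<?N}"
      then obtain I where "I < ?N" "x = e I" by blast
      then show "x \<in> X" using e gX(1) by (metis offset_cases)
    next
      fix x assume x: "x \<in> X"
      then obtain p where p: "p < r (h x)" "x = g (h x) p"
        using bij_betw_imp_surj_on[OF g[of "h x"]] by blast
      moreover have "h x < n" using x h by auto
      ultimately show "x \<in> e ` {..<?N}"
        using offset_less[of "h x" n p r] e[OF p(1)] by (metis imageI lessThan_iff)
    qed
  qed
  with he show ?thesis using that by blast
qed

section \<open>Stems and cycles\<close>

lemma vwalk_arc:
  assumes "vwalk p G" "Suc j < length p"
  shows "(p ! j, p ! Suc j) \<in> arcs_ends G"
proof -
  have "(p ! j, p ! Suc j) \<in> set (vwalk_arcs p)"
    using assms(2)
  proof (induction p arbitrary: j rule: vwalk_arcs.induct)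
    case (3 x y xs)
    then show ?case by (cases j) auto
  qed simp_all
  then show ?thesis using assms(1) unfolding vwalk_def by blast
qed

lemma stem_or_cycle_arc:
  assumes "stem S p \<or> is_cycle S p" "0 < j" "j < length p"
  shows "(p ! (j - 1), p ! j) \<in> parcs (graph_of S)"
proof -
  have "vwalk p (with_proj (graph_of S))"
    using assms(1) unfolding stem_def vpath_def is_cycle_def by blast
  from vwalk_arc[OF this, of "j - 1"] show ?thesis using assms(2,3) by simp
qed

lemma stem_reachable:
  assumes "stem S p"
  shows "(hd p, last p) \<in> (parcs (graph_of S))\<^sup>*"
proof -
  have p: "p \<noteq> []" using assms unfolding stem_def vpath_def vwalk_def by blast
  have "(p ! 0, p ! j) \<in> (parcs (graph_of S))\<^sup>*" if "j < length p" for j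
    using that
  proof (induction j)
    case (Suc j)
    then show ?case
      using stem_or_cycle_arc[of S p "Suc j"] assms by (auto intro: rtrancl_into_rtrancl)
  qed simp
  from this[of "length p - 1"] show ?thesis using p by (simp add: hd_conv_nth last_conv_nth)
qed

text \<open>A state at position 0 can only be the start of a cycle, and there it recurs at the last
  position.\<close>

lemma stem_or_cycle_state_position:
  assumes "stem S p \<or> is_cycle S p" "State i \<in> set p"
  obtains j where "0 < j" "j < length p" "p ! j = State i"
proof -
  obtain j where j: "j < length p" "p ! j = State i" using assms(2) by (metis in_set_conv_nth)
  have p: "p \<noteq> []" using assms(2) by auto
  show ?thesis
  proof (cases "j = 0")
    case True
    then have "hd p = State i" using j p by (simp add: hd_conv_nth)
    then have "is_cycle S p" using assms(1) unfolding stem_def by auto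
    then show ?thesis
      using that[of "length p - 1"] \<open>hd p = State i\<close> p
      unfolding is_cycle_def by (simp add: last_conv_nth)
  qed (use j that in simp)
qed

section \<open>Making the stems and cycles of an X-network disjoint\<close>

theorem theorem2:
  fixes S :: structured_system
  assumes "X_network S"
  shows "\<exists>nh Sh. extended_system S nh Sh \<and> homogeneous_internal_dynamics S nh Sh \<and>
           structurally_controllable Sh"
proof -
  define n where "n = dim_row (sys_A S)"
  define m where "m = dim_col (sys_B S)"
  let ?E = "parcs (graph_of S)"
  obtain P where orig: "original_network S" and acc: "input_accessible S"
    and P: "\<And>p. p \<in> P \<Longrightarrow> stem S p \<or> is_cycle S p"
    and cov: "covers P (State ` {..<n})"
    and one_stem: "\<not> distinct_stems_from_same_input S P"
    using assms unfolding X_network_def n_def by blast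
  have "\<forall>i<n. \<exists>p\<in>P. State i \<in> set p" using cov unfolding covers_def by auto
  \<comment> \<open>One member of \<open>P\<close> for each state: this finite subfamily keeps the
    extension finite-dimensional even if \<open>P\<close> is infinite.\<close>
  then obtain q where q: "\<And>i. i < n \<Longrightarrow> q i \<in> P" "\<And>i. i < n \<Longrightarrow> State i \<in> set (q i)" by metis

  \<comment> \<open>One copy of a state for each of its occurrences in the chosen stems and cycles; position 0 is
    an input or repeats the last node of a cycle.\<close>
  define X where "X = (SIGMA p:q ` {..<n}. {0<..<length p})"
  define h where "h = (\<lambda>(p :: node list, j). case p ! j of State i \<Rightarrow> i | Input s \<Rightarrow> s)"
  define r where "r = (\<lambda>i. card {x \<in> X. h x = i})"
  define N where "N = (\<Sum>i<n. r i)"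
  let ?F = "full_extension S r"
  have finX: "finite X" unfolding X_def by auto
  have XD: "p \<in> P" "stem S p \<or> is_cycle S p" "0 < j" "j < length p" if "(p, j) \<in> X" for p j
    using that q(1) P unfolding X_def by auto
  have arc: "(p ! (j - 1), p ! j) \<in> ?E" if "(p, j) \<in> X" for p j
    by (rule stem_or_cycle_arc[OF XD(2-4)[OF that]])
  have node: "p ! j = State (h (p, j))" "h (p, j) < n" if x: "(p, j) \<in> X" for p j
  proof -
    obtain i where "p ! j = State i" "i < n"
      using parcs_to_state[OF arc[OF x]] unfolding n_def by metis
    then show "p ! j = State (h (p, j))" "h (p, j) < n" unfolding h_def by simp_all
  qed
  have hX: "h ` X \<subseteq> {..<n}" using node(2) by auto
  have r1: "r i \<ge> 1" if i: "i < n" for i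
  proof -
    obtain j where "0 < j" "j < length (q i)" "q i ! j = State i"
      using stem_or_cycle_state_position[OF P[OF q(1)[OF i]] q(2)[OF i]] by blast
    then have "(q i, j) \<in> {x \<in> X. h x = i}" using i unfolding X_def h_def by auto
    then show ?thesis using finX unfolding r_def by (auto simp: Suc_le_eq card_gt_0_iff)
  qed
  obtain e where e: "bij_betw e {..<N} X" and he: "\<And>I. I < N \<Longrightarrow> h (e I) = block_index r I"
    using ex_block_enumeration[OF finX hX] unfolding N_def r_def by blast
  define e' where "e' = the_inv_into {..<N} e"
  have e': "e' x < N" "e (e' x) = x" if "x \<in> X" for x
    using bij_betwE[OF bij_betw_the_inv_into[OF e]] f_the_inv_into_f_bij_betw[OF e] that
    unfolding e'_def by auto
  have e'_inj: "x = y" if "e' x = e' y" "x \<in> X" "y \<in> X" for x y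
    using that e'(2) by metis

  \<comment> \<open>\<open>prev\<close> rotates the positions \<open>1, ..., length p - 1\<close> of
    each walk and is therefore injective. The wrap from 1 to the end is correct on a cycle, whose
    last node repeats the first; on a stem, \<open>first\<close> catches position 1 and the
    predecessor is the input.\<close>
  define prev where "prev = (\<lambda>(p :: node list, j). (p, if j = 1 then length p - 1 else j - 1))"
  define first where "first = (\<lambda>(p, j). stem S p \<and> j = (1 :: nat))"
  \<comment> \<open>The predecessor map on the extension; \<open>e\<close> and \<open>e'\<close>
    pass between its states and the occurrences in \<open>X\<close>.\<close>
  define f where "f x = (case x of Input s \<Rightarrow> Input s | State I \<Rightarrow>
      if first (e I) then hd (fst (e I)) else State (e' (prev (e I))))" for x
  have prevX: "prev x \<in> X" if "x \<in> X" for x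
    using that unfolding X_def prev_def by (auto split: if_splits)
  have prev_inj: "x = y" if "prev x = prev y" "x \<in> X" "y \<in> X" for x y
    using that unfolding X_def prev_def by (auto split: if_splits)
  have eX: "e I \<in> X" if "I < N" for I using bij_betwE[OF e] that by blast
  have head: "stem S p \<Longrightarrow> \<exists>s. hd p = Input s" for p unfolding stem_def by auto

  have inj: "inj_on f (State ` {..<N})"
  proof (rule inj_onI)
    fix x y assume "x \<in> State ` {..<N}" "y \<in> State ` {..<N}" and eq: "f x = f y"
    then obtain I J where I: "x = State I" "I < N" and J: "y = State J" "J < N" by blast
    obtain p j where p: "e I = (p, j)" by fastforce
    obtain p' j' where p': "e J = (p', j')" by fastforce
    have X: "(p, j) \<in> X" "(p', j') \<in> X" using eX I(2) J(2) p p' by metis+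
    have fx: "f x = (if first (p, j) then hd p else State (e' (prev (p, j))))"
      and fy: "f y = (if first (p', j') then hd p' else State (e' (prev (p', j'))))"
      unfolding f_def I(1) J(1) by (simp_all add: p p')
    have "(p, j) = (p', j')"
    proof (cases "first (p, j)")
      case True
      then have st: "stem S p" "j = 1" unfolding first_def by auto
      then have "first (p', j')" using eq True head fx fy by (metis node.distinct(1))
      then have st': "stem S p'" "j' = 1" "hd p = hd p'"
        using eq True fx fy unfolding first_def by auto
      \<comment> \<open>Here the exclusion of distinct stems from the same input enters: without it
        two first states could share their predecessor.\<close>
      then have "p = p'"
        using one_stem XD(1) X st unfolding distinct_stems_from_same_input_def by blast
      then show ?thesis using st st' by simp
    next
      case False
      have "\<not> first (p', j')"
      proof
        assume "first (p', j')"
        then obtain s where "hd p' = Input s" using head unfolding first_def by auto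
        then show False using eq fx fy False \<open>first (p', j')\<close> by simp
      qed
      then have "e' (prev (p, j)) = e' (prev (p', j'))" using False eq fx fy by simp
      then show ?thesis using e'_inj prev_inj prevX X by blast
    qed
    then have "e I = e J" using p p' by simp
    then show "x = y" using bij_betw_imp_inj_on[OF e] I J by (auto dest: inj_onD)
  qed

  have edge: "(f (State I), State I) \<in> parcs (graph_of ?F)" if I: "I < N" for I
  proof -
    obtain p j where p: "e I = (p, j)" by fastforce
    then have X: "(p, j) \<in> X" using eX[OF I] by simp
    have pj: "p ! j = State (block_index r I)" using node(1)[OF X] he[OF I] p by simp
    have "p \<noteq> []" using XD(4)[OF X] by auto
    show ?thesis
    proof (cases "first (p, j)")
      case True
      then obtain s where s: "hd p = Input s" "j = 1" using head unfolding first_def by auto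
      have "(Input s, State (block_index r I)) \<in> ?E"
        using arc[OF X] pj s \<open>p \<noteq> []\<close> by (simp add: hd_conv_nth)
      then have "(Input s, State I) \<in> parcs (graph_of ?F)"
        using I parcs_full_extension(2) unfolding N_def n_def by blast
      then show ?thesis using True s(1) by (simp add: f_def p)
    next
      case False
      define K where "K = e' (prev (p, j))"
      have K: "K < N" "e K = prev (p, j)" using e' prevX X unfolding K_def by auto
      \<comment> \<open>Positions \<open>k\<close> and \<open>j - 1\<close> differ only for
        \<open>j = 1\<close>, where the cycle closes up and both carry its starting node.\<close>
      obtain k where k: "prev (p, j) = (p, k)" "(p, k) \<in> X" "p ! k = p ! (j - 1)"
      proof (cases "j = 1")
        case True
        then have "is_cycle S p" using False XD(2)[OF X] unfolding first_def by auto
        then have "p ! (length p - 1) = p ! 0"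
          using \<open>p \<noteq> []\<close> unfolding is_cycle_def by (simp add: hd_conv_nth last_conv_nth)
        then show ?thesis using that prevX[OF X] True unfolding prev_def by simp
      next
        case False
        then show ?thesis using that prevX[OF X] unfolding prev_def by simp
      qed
      have "p ! k = State (block_index r K)" using node(1)[OF k(2)] he[OF K(1)] K(2) k(1) by simp
      then have "(State (block_index r K), State (block_index r I)) \<in> ?E"
        using arc[OF X] k(3) pj by simp
      then have "(State K, State I) \<in> parcs (graph_of ?F)"
        using I K(1) parcs_full_extension(1) unfolding N_def n_def by blast
      then show ?thesis using False by (simp add: f_def p K_def)
    qed
  qed

  have reach: "\<exists>s<m. (Input s, State I) \<in> (parcs (graph_of ?F))\<^sup>*" if I: "I < N" for I
  proof -
    have "block_index r I < n" using block_index_less I unfolding N_def by blast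
    then obtain p where p: "stem S p" "last p = State (block_index r I)"
      using acc unfolding input_accessible_def n_def by blast
    then obtain s where s: "hd p = Input s" using head by blast
    have "p \<noteq> []" "set p \<subseteq> pverts (graph_of S)"
      using p(1) unfolding stem_def vpath_def vwalk_def by auto
    then have "Input s \<in> pverts (graph_of S)" using s by (metis hd_in_set subsetD)
    then have "s < m" unfolding graph_of_def Let_def m_def by auto
    moreover have "(Input s, State I) \<in> (parcs (graph_of ?F))\<^sup>*"
      using full_extension_reachable[of S r s "block_index r I" I] r1 stem_reachable[OF p(1)] s p(2) I
      unfolding N_def n_def by auto
    ultimately show ?thesis by blast
  qed

  have ext: "extended_system S r ?F" "homogeneous_internal_dynamics S r ?F"
    using full_extension[OF orig] r1 unfolding n_def by blast+
  have sel: "sys_A ?F \<in> carrier_mat N N" "sys_B ?F \<in> carrier_mat N m"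
    by (simp_all add: full_extension_def Let_def n_def m_def N_def)
  have less: "block_index r I < n" if "I < N" for I
    using block_index_less that unfolding N_def by blast
  have "structurally_controllable ?F"
  proof (rule structurally_controllableI[OF sel _ _ inj edge reach])
    show "elements_mat (sys_A ?F) \<subseteq> {Free, Fixed 0}"
    proof (rule elements_mat_subsetI)
      fix I J assume "I < dim_row (sys_A ?F)" "J < dim_col (sys_A ?F)"
      then have IJ: "I < N" "J < N" using sel by auto
      then have "sys_A ?F $$ (I, J) = sys_A S $$ (block_index r I, block_index r J)"
        by (simp add: full_extension_def Let_def n_def N_def)
      then show "sys_A ?F $$ (I, J) \<in> {Free, Fixed 0}"
        using original_network_entries(1)[OF orig] less IJ unfolding n_def by metis
    qed
    show "elements_mat (sys_B ?F) \<subseteq> {Free, Fixed 0}"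
    proof (rule elements_mat_subsetI)
      fix I s assume "I < dim_row (sys_B ?F)" "s < dim_col (sys_B ?F)"
      then have Is: "I < N" "s < m" using sel by auto
      then have "sys_B ?F $$ (I, s) = sys_B S $$ (block_index r I, s)"
        by (simp add: full_extension_def Let_def n_def m_def N_def)
      then show "sys_B ?F $$ (I, s) \<in> {Free, Fixed 0}"
        using original_network_entries(2)[OF orig] less Is unfolding n_def m_def by metis
    qed
  qed
  with ext show ?thesis by blast
qed

end
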